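(* Let $\{x_k\}_{k\ge0}$ be generated by the stochastic block Bregman projection (SBBP) method under the sampling rule described in the context, with $t_k$ at every iteration given by the exact projective stepsize, or $t_k$ at every iteration given by the inexact projective (block adaptive extrapolated) stepsize (both defined in the context). Suppose the Bregman distance growth condition holds with constant $\gamma>0$, and let $L,L_\tau^{\mathrm{block}}\in(0,1]$ be the stochastic and block smooth regularity constants defined in the context. Then $\{x_k\}_{k\ge0}$ converges to the set $\bar X$ linearly in expectation: for all $k\ge0$, $$\mathbb{E}\left[\mathrm{dist}_\psi^{x_k^*}(x_k,\bar X)^2\right]\le\left(1-\frac{\gamma^2\mu^2}{4L_{\max}^2L_\tau^{\mathrm{block}}L}\right)^k\mathrm{dist}_\psi^{x_0^*}(x_0,\bar X)^2.$$
   Context: Notation: $[m]=\{1,\dots,m\}$; $\|\cdot\|$ is the Euclidean norm. $C_1,\dots,C_m\subset\mathbb{R}^n$ are closed convex sets with $C=\bigcap_{i=1}^mC_i\ne\emptyset$. Problem data: $\psi:\mathbb{R}^n\to\mathbb{R}$ is $\mu$-strongly convex ($\mu>0$); each $f_i:\mathbb{R}^n\to\mathbb{R}$, $i\in[m]$, is convex and differentiable with $L_i$-Lipschitz gradient, $L_i>0$, and satisfies $f_i(x)\ge0$ for all $x$, with $f_i(x)=0$ if and only if $x\in C_i$; $L_{\max}=\max_{i\in[m]}L_i$; $F(x)=\frac1m\sum_{i=1}^mf_i(x)$; $\bar F=\min F$ and $\bar X=\arg\min_{x\in\mathbb{R}^n}F(x)$ (nonempty; here $\bar X=C$). $\psi^*$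 is the Fenchel conjugate of $\psi$ (differentiable with $1/\mu$-Lipschitz gradient). For $x^*\in\partial\psi(x)$, $D_\psi^{x^*}(x,y)=\psi(y)-\psi(x)-\langle x^*,y-x\rangle$ and $\mathrm{dist}_\psi^{x^*}(x,\bar X)^2=\inf_{z\in\bar X}D_\psi^{x^*}(x,z)$. Bregman distance growth condition with constant $\gamma>0$: for every $x\in\mathbb{R}^n$ ($=\mathrm{int}\,\mathrm{dom}\,\psi$) and every $x^*\in\partial\psi(x)$, $F(x)-\bar F\ge\gamma\inf_{z\in\bar X}D_\psi^{x^*}(x,z)$. Sampling rule: fix $\tau\in\{1,\dots,m\}$. At each iteration $k\ge0$ a random subset $J_k\subset[m]$ with $|J_k|=\tau$ is drawn from a fixed distribution with $\mathbf P(i\in J_k)=\tau/m$ for all $i\in[m]$, independently of $J_0,\dots,J_{k-1}$; weights are $w_{i,k}=1/\tau$, $i\in J_k$. SBBP method: $x_0\in\mathbb{R}^n$, $x_0^*\in\partial\psi(x_0)$, $\alpha_k=\sum_{i\in J_k}w_{i,k}\nabla f_i(x_k)$, and $x_{k+1}^*=x_k^*-t_k\alpha_k$, $x_{k+1}=\nabla\psi^*(x_{k+1}^* )$. Stepsizes: with $\beta_k=\langle\alpha_k,x_k\rangle-\sum_{i\in J_k}\frac{w_{i,k}}{L_i}\|\nabla f_i(x_k)\|^2$, the exact projective stepsize is a solution $t_k$ of $\min_{t\in\mathbb{R}}\psi^*(x_k^*-t\alpha_k)+t\beta_k$. The block adaptive extrapolated stepsize is $t_k=\frac{\mu}{L_{\max}L_{\mathrm{adapt}}^{k,\tau}}$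 with $L_{\mathrm{adapt}}^{k,\tau}=\frac{\|\sum_{i\in J_k}w_{i,k}\nabla f_i(x_k)\|^2}{\sum_{i\in J_k}w_{i,k}\|\nabla f_i(x_k)\|^2}$. If $\nabla f_i(x_k)=0$ for all $i\in J_k$, then $\alpha_k=0$ and the stepsize is irrelevant ($x_{k+1}^*=x_k^*$, $x_{k+1}=x_k$). Regularity constants (convention $0/0=0$): $$L=\sup_{x\in\mathbb{R}^n}\frac{\|\frac1m\sum_{i=1}^m\nabla f_i(x)\|^2}{\frac1m\sum_{i=1}^m\|\nabla f_i(x)\|^2},\qquad L_\tau^{\mathrm{block}}=\sup_{k\ge0}\frac{\|\sum_{i\in J_k}w_{i,k}\nabla f_i(x_k)\|^2}{\sum_{i\in J_k}w_{i,k}\|\nabla f_i(x_k)\|^2},$$ the second supremum being also over all realizations of the random samples, so that $L_\tau^{\mathrm{block}}$ is a deterministic constant. Both are taken to lie in $(0,1]$ (the value $0$ occurs only if all gradients concerned vanish). *)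

theory Defs
  imports "HOL-Probability.Probability"
begin

definition strongly_convex :: "real \<Rightarrow> ('a::real_inner \<Rightarrow> real) \<Rightarrow> bool" where
  "strongly_convex \<mu> \<psi> \<longleftrightarrow>
    (\<forall>x y. \<forall>s\<in>{0..1}. \<psi> ((1 - s) *\<^sub>R x + s *\<^sub>R y)
      \<le> (1 - s) * \<psi> x + s * \<psi> y - \<mu> / 2 * s * (1 - s) * (norm (x - y))\<^sup>2)"

definition subdifferential :: "('a::real_inner \<Rightarrow> real) \<Rightarrow> 'a \<Rightarrow> 'a set" where
  "subdifferential \<psi> x = {g. \<forall>y. \<psi> x + g \<bullet> (y - x) \<le> \<psi> y}"

(* Meaningful only at points where f is differentiable. *)
definition gradient :: "('a::real_inner \<Rightarrow> real) \<Rightarrow> 'a \<Rightarrow> 'a" where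
  "gradient f x = (THE g. GDERIV f x :> g)"

(* The supremum is taken in the reals. It is finite for every y when the real-valued
   function psi is strongly convex on a finite-dimensional space. *)
definition fenchel_conjugate :: "('a::real_inner \<Rightarrow> real) \<Rightarrow> 'a \<Rightarrow> real" where
  "fenchel_conjugate \<psi> y = (SUP x. y \<bullet> x - \<psi> x)"

definition argmin_set :: "('a \<Rightarrow> real) \<Rightarrow> 'a set" where
  "argmin_set F = {x. is_arg_min F (\<lambda>_. True) x}"

definition bregman :: "('a::real_inner \<Rightarrow> real) \<Rightarrow> 'a \<Rightarrow> 'a \<Rightarrow> 'a \<Rightarrow> real" where
  "bregman \<psi> xs x y = \<psi> y - \<psi> x - xs \<bullet> (y - x)"

(* The square of the Bregman distance from x to X. For xs in the subdifferential of psi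
   at x all the values are nonnegative, so the real infimum is genuine if X is nonempty. *)
definition bregman_dist_sq :: "('a::real_inner \<Rightarrow> real) \<Rightarrow> 'a \<Rightarrow> 'a \<Rightarrow> 'a set \<Rightarrow> real" where
  "bregman_dist_sq \<psi> xs x X = (INF z\<in>X. bregman \<psi> xs x z)"

definition bregman_growth :: "('a::real_inner \<Rightarrow> real) \<Rightarrow> ('a \<Rightarrow> real) \<Rightarrow> real \<Rightarrow> bool" where
  "bregman_growth \<psi> F \<gamma> \<longleftrightarrow>
    (\<forall>x. \<forall>xs\<in>subdifferential \<psi> x.
      F x - (INF y. F y) \<ge> \<gamma> * bregman_dist_sq \<psi> xs x (argmin_set F))"

definition mean_fun :: "nat \<Rightarrow> (nat \<Rightarrow> 'a \<Rightarrow> real) \<Rightarrow> 'a \<Rightarrow> real" where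
  "mean_fun m f x = (1 / real m) * (\<Sum>i\<in>{1..m}. f i x)"

(* w is the common value of the weights: 1 / tau for a block, 1 / m for the full index set. *)
definition block_grad ::
    "real \<Rightarrow> (nat \<Rightarrow> 'a::real_inner \<Rightarrow> real) \<Rightarrow> nat set \<Rightarrow> 'a \<Rightarrow> 'a" where
  "block_grad w f I x = (\<Sum>i\<in>I. w *\<^sub>R gradient (f i) x)"

(* Where all the gradients vanish this is 0, because 0 / 0 = 0. *)
definition smooth_ratio ::
    "real \<Rightarrow> (nat \<Rightarrow> 'a::real_inner \<Rightarrow> real) \<Rightarrow> nat set \<Rightarrow> 'a \<Rightarrow> real" where
  "smooth_ratio w f I x =
    (norm (block_grad w f I x))\<^sup>2 / (\<Sum>i\<in>I. w * (norm (gradient (f i) x))\<^sup>2)"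

(* In both suprema below the ratios lie between 0 and 1, because the weights sum to 1
   (for the second one if every block has tau elements). *)
definition stochastic_regularity :: "nat \<Rightarrow> (nat \<Rightarrow> 'a::real_inner \<Rightarrow> real) \<Rightarrow> real" where
  "stochastic_regularity m f = (SUP x. smooth_ratio (1 / real m) f {1..m} x)"

definition block_regularity ::
    "'w set \<Rightarrow> nat \<Rightarrow> (nat \<Rightarrow> 'a::real_inner \<Rightarrow> real) \<Rightarrow> (nat \<Rightarrow> 'w \<Rightarrow> nat set)
      \<Rightarrow> (nat \<Rightarrow> 'w \<Rightarrow> 'a) \<Rightarrow> real" where
  "block_regularity \<Omega> \<tau> f J x =
    (SUP (k, \<omega>)\<in>UNIV \<times> \<Omega>. smooth_ratio (1 / real \<tau>) f (J k \<omega>) (x k \<omega>))"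

definition block_offset ::
    "real \<Rightarrow> (nat \<Rightarrow> real) \<Rightarrow> (nat \<Rightarrow> 'a::real_inner \<Rightarrow> real) \<Rightarrow> nat set \<Rightarrow> 'a \<Rightarrow> real" where
  "block_offset w Lip f I x =
    block_grad w f I x \<bullet> x - (\<Sum>i\<in>I. w / Lip i * (norm (gradient (f i) x))\<^sup>2)"

definition exact_step ::
    "('a::real_inner \<Rightarrow> real) \<Rightarrow> real \<Rightarrow> (nat \<Rightarrow> real) \<Rightarrow> (nat \<Rightarrow> 'a \<Rightarrow> real)
      \<Rightarrow> nat set \<Rightarrow> 'a \<Rightarrow> 'a \<Rightarrow> real \<Rightarrow> bool" where
  "exact_step \<psi> w Lip f I xs x t \<longleftrightarrow>
    is_arg_min (\<lambda>s. fenchel_conjugate \<psi> (xs - s *\<^sub>R block_grad w f I x) + s * block_offset w Lip f I x)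
      (\<lambda>_. True) t"

(* The stepsize is left free where all gradients of the block vanish. *)
definition adaptive_step ::
    "real \<Rightarrow> real \<Rightarrow> real \<Rightarrow> (nat \<Rightarrow> 'a::real_inner \<Rightarrow> real) \<Rightarrow> nat set \<Rightarrow> 'a \<Rightarrow> real \<Rightarrow> bool" where
  "adaptive_step \<mu> Lmax w f I x t \<longleftrightarrow>
    ((\<exists>i\<in>I. gradient (f i) x \<noteq> 0) \<longrightarrow> t = \<mu> / (Lmax * smooth_ratio w f I x))"

definition sbbp ::
    "'w set \<Rightarrow> ('a::real_inner \<Rightarrow> real) \<Rightarrow> real \<Rightarrow> (nat \<Rightarrow> 'a \<Rightarrow> real) \<Rightarrow> (nat \<Rightarrow> 'w \<Rightarrow> nat set)
      \<Rightarrow> (nat \<Rightarrow> 'w \<Rightarrow> real) \<Rightarrow> 'a \<Rightarrow> 'a \<Rightarrow> (nat \<Rightarrow> 'w \<Rightarrow> 'a) \<Rightarrow> (nat \<Rightarrow> 'w \<Rightarrow> 'a) \<Rightarrow> bool" where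
  "sbbp \<Omega> \<psi> w f J t x0 xs0 x xs \<longleftrightarrow>
    xs0 \<in> subdifferential \<psi> x0 \<and>
    (\<forall>\<omega>\<in>\<Omega>. x 0 \<omega> = x0 \<and> xs 0 \<omega> = xs0 \<and>
      (\<forall>k. xs (Suc k) \<omega> = xs k \<omega> - t k \<omega> *\<^sub>R block_grad w f (J k \<omega>) (x k \<omega>) \<and>
           x (Suc k) \<omega> = gradient (fenchel_conjugate \<psi>) (xs (Suc k) \<omega>)))"

definition block_sampling ::
    "'w measure \<Rightarrow> nat \<Rightarrow> nat \<Rightarrow> nat set pmf \<Rightarrow> (nat \<Rightarrow> 'w \<Rightarrow> nat set) \<Rightarrow> bool" where
  "block_sampling M m \<tau> P J \<longleftrightarrow>
    prob_space.indep_vars M (\<lambda>_. count_space UNIV) J UNIV \<and>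
    (\<forall>k. distr M (count_space UNIV) (J k) = measure_pmf P) \<and>
    (\<forall>k. \<forall>\<omega>\<in>space M. J k \<omega> \<subseteq> {1..m} \<and> card (J k \<omega>) = \<tau>) \<and>
    (\<forall>i\<in>{1..m}. measure_pmf.prob P {I. i \<in> I} = real \<tau> / real m)"

(* The k-th stepsize is a function of the samples drawn up to step k. The exact stepsize
   need not be unique; without this condition the choice among the minimizers could depend
   on later samples, and the iterate would not be independent of the next block. *)
definition non_anticipating ::
    "'w set \<Rightarrow> (nat \<Rightarrow> 'w \<Rightarrow> nat set) \<Rightarrow> (nat \<Rightarrow> 'w \<Rightarrow> real) \<Rightarrow> bool" where
  "non_anticipating \<Omega> J t \<longleftrightarrow>
    (\<forall>k. \<forall>\<omega>\<in>\<Omega>. \<forall>\<omega>'\<in>\<Omega>. (\<forall>j\<le>k. J j \<omega> = J j \<omega>') \<longrightarrow> t k \<omega> = t k \<omega>')"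

end

theory Submission
  imports Defs
begin

text \<open>
  For \<open>z\<close> in the solution set, Fenchel--Young equality gives
  \<open>D (Suc k) z = \<psi>\<^sup>* (xs - t *\<^sub>R \<alpha>) + t * (\<alpha> \<bullet> z) + const\<close>, and cocoercivity of the gradients gives
  \<open>\<alpha> \<bullet> z \<le> \<beta>\<close>. As \<open>t \<ge> 0\<close>, the left-hand side is at most the objective of the exact step at
  \<open>t\<close>; the adaptive step minimizes a quadratic majorant of that objective, which comes from the
  \<open>1 / \<mu>\<close>-smoothness of \<open>\<psi>\<^sup>*\<close>. So with either step the Bregman distance drops by
  \<open>\<mu> / (2 * Lmax\<^sup>2 * Lblock)\<close> times the block average of the squared gradient norms. In expectation,
  by independence of the block from the iterate, this average is the full average, which is at
  least \<open>1 / L\<close> times the squared norm of the gradient of \<open>F\<close>. Convexity,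
  \<open>F x \<le> \<nabla>F x \<bullet> (x - z)\<close>, together with the growth condition and
  \<open>\<mu> / 2 * (norm (x - z))\<^sup>2 \<le> D z\<close>, bounds the latter below by \<open>\<gamma>\<^sup>2 * \<mu> / 2\<close> times the
  Bregman distance.
\<close>

section \<open>Gradients, and first-order inequalities for convex and for smooth functions\<close>

lemma GDERIV_unique:
  fixes f :: "'a::real_inner \<Rightarrow> real"
  assumes "GDERIV f x :> a" "GDERIV f x :> b"
  shows "a = b"
proof -
  have "(\<lambda>h. h \<bullet> a) = (\<lambda>h. h \<bullet> b)"
    using assms unfolding gderiv_def by (rule has_derivative_unique)
  then have "(a - b) \<bullet> a = (a - b) \<bullet> b"
    by (rule fun_cong)
  then have "(a - b) \<bullet> (a - b) = 0"
    by (simp add: inner_diff_right)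
  then show ?thesis by simp
qed

lemma gradient_eqI:
  assumes "GDERIV f x :> g"
  shows "gradient f x = g"
  unfolding gradient_def using assms GDERIV_unique by (intro the_equality) blast+

text \<open>Riesz representation in coordinates: the derivative is linear, hence the inner product
  with the vector of its values on the basis. This links differentiability to
  \<open>gradient\<close>, which is a definite description.\<close>

lemma GDERIV_gradient:
  fixes f :: "'a::euclidean_space \<Rightarrow> real"
  assumes "f differentiable (at x)"
  shows "GDERIV f x :> gradient f x"
proof -
  obtain f' where f': "(f has_derivative f') (at x)"
    using assms by (auto simp: differentiable_def)
  interpret linear f' using f' by (rule has_derivative_linear)
  have "f' h = h \<bullet> (\<Sum>b\<in>Basis. f' b *\<^sub>R b)" for h
  proof -
    have "f' h = f' (\<Sum>b\<in>Basis. (h \<bullet> b) *\<^sub>R b)" by (simp add: euclidean_representation)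
    also have "\<dots> = (\<Sum>b\<in>Basis. (h \<bullet> b) * f' b)" by (simp add: sum scale)
    also have "\<dots> = h \<bullet> (\<Sum>b\<in>Basis. f' b *\<^sub>R b)"
      by (simp add: inner_sum_right mult.commute)
    finally show ?thesis .
  qed
  then have "f' = (\<lambda>h. h \<bullet> (\<Sum>b\<in>Basis. f' b *\<^sub>R b))" by blast
  with f' have "GDERIV f x :> (\<Sum>b\<in>Basis. f' b *\<^sub>R b)"
    unfolding gderiv_def by simp
  then show ?thesis using gradient_eqI by metis
qed

lemma GDERIV_line:
  fixes f :: "'a::real_inner \<Rightarrow> real"
  assumes "GDERIV f (x + s *\<^sub>R d) :> g"
  shows "((\<lambda>s. f (x + s *\<^sub>R d)) has_real_derivative (g \<bullet> d)) (at s)"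
proof -
  have "((\<lambda>s. x + s *\<^sub>R d) has_derivative (\<lambda>h. h *\<^sub>R d)) (at s)"
    by (auto intro!: derivative_eq_intros)
  moreover have "(f has_derivative (\<lambda>h. h \<bullet> g)) (at (x + s *\<^sub>R d))"
    using assms by (simp add: gderiv_def)
  ultimately have "((\<lambda>s. f (x + s *\<^sub>R d)) has_derivative (\<lambda>h. (h *\<^sub>R d) \<bullet> g)) (at s)"
    by (rule has_derivative_compose)
  moreover have "(\<lambda>h. (h *\<^sub>R d) \<bullet> g) = (*) (g \<bullet> d)"
    by (auto simp: inner_commute)
  ultimately show ?thesis by (simp add: has_field_derivative_def)
qed

text \<open>Along the line through \<open>x\<close> and \<open>y\<close> this is the tangent
  inequality for a convex function of one real variable.\<close>

lemma convex_gradient_ineq: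
  fixes f :: "'a::euclidean_space \<Rightarrow> real"
  assumes "convex_on UNIV f" and "f differentiable (at x)"
  shows "f x + gradient f x \<bullet> (y - x) \<le> f y"
proof -
  let ?h = "\<lambda>s. f (x + s *\<^sub>R (y - x))"
  have conv: "convex_on UNIV ?h"
  proof (rule convex_onI)
    fix t a b :: real assume t: "0 < t" "t < 1"
    have "x + ((1 - t) *\<^sub>R a + t *\<^sub>R b) *\<^sub>R (y - x)
      = (1 - t) *\<^sub>R (x + a *\<^sub>R (y - x)) + t *\<^sub>R (x + b *\<^sub>R (y - x))"
      by (simp add: algebra_simps)
    then show "?h ((1 - t) *\<^sub>R a + t *\<^sub>R b) \<le> (1 - t) * ?h a + t * ?h b"
      using convex_onD[OF assms(1), of t] t by simp
  qed auto
  have "(?h has_real_derivative gradient f x \<bullet> (y - x)) (at 0)"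
    using GDERIV_line[of f x 0 "y - x"] GDERIV_gradient[OF assms(2)] by simp
  with conv have "?h 1 - ?h 0 \<ge> gradient f x \<bullet> (y - x) * (1 - 0)"
    by (intro convex_on_imp_above_tangent[where A = UNIV]) auto
  then show ?thesis by simp
qed

text \<open>Along the segment, the difference \<open>?h\<close> of the two sides has derivative at
  most 0 by Cauchy-Schwarz and the Lipschitz bound. Monotonicity of \<open>?h\<close> replaces the
  usual integral of the gradient.\<close>

lemma lipschitz_gradient_descent:
  fixes f :: "'a::euclidean_space \<Rightarrow> real"
  assumes diff: "\<And>y. f differentiable (at y)" and lip: "K-lipschitz_on UNIV (gradient f)"
  shows "f (x + d) \<le> f x + gradient f x \<bullet> d + K / 2 * (norm d)\<^sup>2"
proof -
  let ?h = "\<lambda>s. f (x + s *\<^sub>R d) - s * (gradient f x \<bullet> d) - K / 2 * s\<^sup>2 * (norm d)\<^sup>2"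
  have "?h 1 \<le> ?h 0"
  proof (rule DERIV_nonpos_imp_nonincreasing[where f = ?h])
    fix s :: real assume s: "0 \<le> s" "s \<le> 1"
    let ?D = "gradient f (x + s *\<^sub>R d) \<bullet> d - gradient f x \<bullet> d - K * s * (norm d)\<^sup>2"
    have "(?h has_real_derivative ?D) (at s)"
      by (rule derivative_eq_intros GDERIV_line GDERIV_gradient diff refl)+ simp
    moreover have "?D \<le> 0"
    proof -
      have "(gradient f (x + s *\<^sub>R d) - gradient f x) \<bullet> d
          \<le> norm (gradient f (x + s *\<^sub>R d) - gradient f x) * norm d"
        by (rule norm_cauchy_schwarz)
      also have "\<dots> \<le> (K * norm (s *\<^sub>R d)) * norm d"
        using lipschitz_onD[OF lip, of "x + s *\<^sub>R d" x]
        by (intro mult_right_mono) (auto simp: dist_norm)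
      also have "\<dots> = K * s * (norm d)\<^sup>2" using s by (simp add: power2_eq_square)
      finally show ?thesis by (simp add: inner_diff_left)
    qed
    ultimately show "\<exists>y. (?h has_real_derivative y) (at s) \<and> y \<le> 0" by blast
  qed simp
  then show ?thesis by simp
qed

text \<open>The factor is \<open>1 / K\<close> rather than the \<open>1 / (2 * K)\<close> that convexity and the descent
  inequality at \<open>x\<close> alone would give; the descent inequality is applied at the zero \<open>z\<close>,
  in the direction \<open>gradient f x\<close>.\<close>

lemma gradient_cocoercive_at_zero:
  fixes f :: "'a::euclidean_space \<Rightarrow> real"
  assumes conv: "convex_on UNIV f" and diff: "\<And>y. f differentiable (at y)"
    and lip: "K-lipschitz_on UNIV (gradient f)" and K: "K > 0"
    and nonneg: "\<And>y. f y \<ge> 0" and z: "f z = 0"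
  shows "(norm (gradient f x))\<^sup>2 / K \<le> gradient f x \<bullet> (x - z)"
proof -
  \<comment> \<open>A gradient step of length \<open>1 / K\<close> from \<open>y\<close> lowers the
    upper bound by exactly this quotient, and \<open>f\<close> cannot fall below 0.\<close>
  have bound: "(norm (gradient f y))\<^sup>2 / (2 * K) \<le> f y" for y
  proof -
    have "0 \<le> f (y + (- 1 / K) *\<^sub>R gradient f y)" by (rule nonneg)
    also have "\<dots> \<le> f y + gradient f y \<bullet> ((- 1 / K) *\<^sub>R gradient f y)
        + K / 2 * (norm ((- 1 / K) *\<^sub>R gradient f y))\<^sup>2"
      using diff lip by (rule lipschitz_gradient_descent)
    also have "\<dots> = f y - (norm (gradient f y))\<^sup>2 / (2 * K)"
      using K by (simp add: power2_norm_eq_inner[symmetric] power_mult_distrib power_divide field_simps power2_eq_square)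
    finally show ?thesis by simp
  qed
  have gz: "gradient f z = 0"
    using bound[of z] z K by (simp add: divide_le_0_iff)
  \<comment> \<open>Among the points \<open>z + s *\<^sub>R gradient f x\<close>, the value
    \<open>s = 1 / K\<close> makes the combination of convexity at \<open>x\<close> and descent at
    \<open>z\<close> sharpest. It yields one half of the claim; \<open>bound\<close> at
    \<open>x\<close> supplies the other half.\<close>
  let ?u = "z + (1 / K) *\<^sub>R gradient f x"
  have "f x + gradient f x \<bullet> (?u - x) \<le> f ?u"
    using conv diff by (rule convex_gradient_ineq)
  also have "\<dots> \<le> f z + gradient f z \<bullet> ((1 / K) *\<^sub>R gradient f x)
      + K / 2 * (norm ((1 / K) *\<^sub>R gradient f x))\<^sup>2"
    using diff lip by (rule lipschitz_gradient_descent)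
  also have "\<dots> = (norm (gradient f x))\<^sup>2 / (2 * K)"
    using K z gz by (simp add: power_mult_distrib power_divide field_simps power2_eq_square)
  finally have "f x + gradient f x \<bullet> (z - x) + (norm (gradient f x))\<^sup>2 / K
      \<le> (norm (gradient f x))\<^sup>2 / (2 * K)"
    by (simp add: inner_diff_right inner_add_right power2_norm_eq_inner)
  moreover have "(norm (gradient f x))\<^sup>2 / K = 2 * ((norm (gradient f x))\<^sup>2 / (2 * K))"
    by simp
  ultimately show ?thesis using bound[of x] unfolding inner_diff_right by linarith
qed

section \<open>Strong convexity: growth of the Bregman distance and existence of subgradient
  points\<close>

lemma strongly_convex_bregman_ge:
  assumes sc: "strongly_convex \<mu> \<psi>" and g: "g \<in> subdifferential \<psi> x"
  shows "\<mu> / 2 * (norm (x - y))\<^sup>2 \<le> bregman \<psi> g x y"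
proof -
  let ?N = "\<mu> / 2 * (norm (x - y))\<^sup>2"
  \<comment> \<open>The subgradient inequality and strong convexity are compared at the point
    \<open>(1 - s) *\<^sub>R x + s *\<^sub>R y\<close> and divided by \<open>s\<close>. The limit of
    \<open>s\<close> to 0 from the right then removes the factor \<open>1 - s\<close>.\<close>
  have "(1 - s) * ?N \<le> bregman \<psi> g x y" if s: "0 < s" "s < 1" for s
  proof -
    have "\<psi> x + g \<bullet> (((1 - s) *\<^sub>R x + s *\<^sub>R y) - x) \<le> \<psi> ((1 - s) *\<^sub>R x + s *\<^sub>R y)"
      using g by (auto simp: subdifferential_def)
    also have "\<dots> \<le> (1 - s) * \<psi> x + s * \<psi> y - \<mu> / 2 * s * (1 - s) * (norm (x - y))\<^sup>2"
      using sc s unfolding strongly_convex_def by simp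
    finally have "s * ((1 - s) * ?N) \<le> s * bregman \<psi> g x y"
      by (simp add: bregman_def algebra_simps)
    with s show ?thesis by simp
  qed
  then have ev: "\<forall>\<^sub>F s in at_right 0. (1 - s) * ?N \<le> bregman \<psi> g x y"
    by (intro eventually_at_rightI[of 0 1]) auto
  have "((\<lambda>s. (1 - s) * ?N) \<longlongrightarrow> (1 - 0) * ?N) (at_right (0::real))"
    by (intro tendsto_intros)
  from tendsto_upperbound[OF this ev] show ?thesis by simp
qed

lemma strongly_convex_imp_continuous:
  fixes \<psi> :: "'a::euclidean_space \<Rightarrow> real"
  assumes "strongly_convex \<mu> \<psi>" "\<mu> > 0"
  shows "continuous_on UNIV \<psi>"
proof (rule convex_on_continuous)
  show "convex_on UNIV \<psi>"
  proof (rule convex_onI)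
    fix t :: real and x y :: 'a assume t: "0 < t" "t < 1"
    then have "0 \<le> \<mu> / 2 * t * (1 - t) * (norm (x - y))\<^sup>2" using assms(2) by simp
    moreover have "\<psi> ((1 - t) *\<^sub>R x + t *\<^sub>R y)
        \<le> (1 - t) * \<psi> x + t * \<psi> y - \<mu> / 2 * t * (1 - t) * (norm (x - y))\<^sup>2"
      using assms(1) t unfolding strongly_convex_def by simp
    ultimately show "\<psi> ((1 - t) *\<^sub>R x + t *\<^sub>R y) \<le> (1 - t) * \<psi> x + t * \<psi> y" by linarith
  qed auto
qed auto

text \<open>A point has \<open>y\<close> as a subgradient exactly if it minimizes
  \<open>\<psi>\<close> minus the linear form of \<open>y\<close>. Strong convexity makes this
  function coercive, so the search for a minimizer reduces to a ball, which is compact.\<close>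

lemma strongly_convex_subdifferential_surj:
  fixes \<psi> :: "'a::euclidean_space \<Rightarrow> real"
  assumes sc: "strongly_convex \<mu> \<psi>" and \<mu>: "\<mu> > 0"
  obtains x where "y \<in> subdifferential \<psi> x"
proof -
  define h where "h x = \<psi> x - y \<bullet> x" for x
  have cont: "continuous_on A h" for A
    unfolding h_def using strongly_convex_imp_continuous[OF sc \<mu>]
    by (intro continuous_intros) (auto intro: continuous_on_subset)
  have "compact (cball (0::'a) 1)" "cball (0::'a) 1 \<noteq> {}" by auto
  then obtain a where a: "\<And>x. norm x \<le> 1 \<Longrightarrow> h a \<le> h x" "norm a \<le> 1"
    using continuous_attains_inf[OF _ _ cont] by (metis mem_cball_0)
  \<comment> \<open>Chosen such that \<open>norm x > R\<close> makes the quadratic gain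
    \<open>\<mu> / 2 * (norm x - 1)\<close> at least \<open>h 0 - h a\<close>, the most that
    \<open>h\<close> can lose between 0 and the unit sphere.\<close>
  define R where "R = 1 + 2 * (h 0 - h a) / \<mu>"
  have a0: "h a \<le> h 0" using a by simp
  then have R: "R \<ge> 1" unfolding R_def using \<mu> by simp
  have far: "h 0 \<le> h x" if x: "norm x > R" for x
  proof -
    define r where "r = norm x"
    have r: "r > 1" "r > R" using x R by (auto simp: r_def)
    \<comment> \<open>Strong convexity on the segment from 0 to \<open>x\<close>, at the point where
      it crosses the unit sphere; there \<open>h\<close> is at least \<open>h a\<close>.\<close>
    have "\<psi> ((1 - 1 / r) *\<^sub>R 0 + (1 / r) *\<^sub>R x)
        \<le> (1 - 1 / r) * \<psi> 0 + 1 / r * \<psi> x - \<mu> / 2 * (1 / r) * (1 - 1 / r) * (norm (0 - x))\<^sup>2"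
      using r by (intro sc[unfolded strongly_convex_def, THEN spec[of _ 0], THEN spec[of _ x], THEN bspec[of _ _ "1 / r"]]) simp
    then have "h ((1 / r) *\<^sub>R x) \<le> (1 - 1 / r) * h 0 + 1 / r * h x - \<mu> / 2 * (1 / r) * (1 - 1 / r) * r\<^sup>2"
      by (simp add: h_def r_def algebra_simps)
    moreover have "h a \<le> h ((1 / r) *\<^sub>R x)"
      using r by (intro a) (auto simp: r_def)
    ultimately have "r * h a \<le> r * ((1 - 1 / r) * h 0 + 1 / r * h x - \<mu> / 2 * (1 / r) * (1 - 1 / r) * r\<^sup>2)"
      using r by (intro mult_left_mono) auto
    also have "\<dots> = (r - 1) * h 0 + h x - \<mu> / 2 * (r - 1) * r"
      using r by (simp add: field_simps power2_eq_square)
    finally have 1: "h x - h 0 \<ge> r * (\<mu> / 2 * (r - 1) - (h 0 - h a))"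
      by (simp add: algebra_simps)
    have "\<mu> / 2 * (r - 1) \<ge> h 0 - h a"
      using r(2) \<mu> unfolding R_def by (simp add: field_simps)
    with r have "0 \<le> r * (\<mu> / 2 * (r - 1) - (h 0 - h a))" by simp
    with 1 show ?thesis by linarith
  qed
  have "compact (cball (0::'a) R)" "cball (0::'a) R \<noteq> {}" using R by auto
  then obtain x where x: "\<And>u. norm u \<le> R \<Longrightarrow> h x \<le> h u"
    using continuous_attains_inf[OF _ _ cont] by (metis mem_cball_0)
  have "h x \<le> h u" for u
  proof (cases "norm u \<le> R")
    case False
    then have "h 0 \<le> h u" using far by simp
    moreover have "h x \<le> h 0" using x R by simp
    ultimately show ?thesis by simp
  qed (use x in simp)
  then have "y \<in> subdifferential \<psi> x"
    unfolding subdifferential_def h_def by (auto simp: inner_diff_right algebra_simps)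
  then show ?thesis by (rule that)
qed

section \<open>The Fenchel conjugate of a strongly convex function\<close>

lemma fenchel_conjugate_eq:
  assumes "y \<in> subdifferential \<psi> x"
  shows "fenchel_conjugate \<psi> y = y \<bullet> x - \<psi> x"
  unfolding fenchel_conjugate_def
proof (rule cSup_eq_maximum)
  fix v assume "v \<in> range (\<lambda>x. y \<bullet> x - \<psi> x)"
  then show "v \<le> y \<bullet> x - \<psi> x"
    using assms by (auto simp: subdifferential_def inner_diff_right algebra_simps)
qed auto

text \<open>In this form \<open>x\<close> enters only through its subgradient \<open>y\<close>, so
  an update of the dual iterate can be followed by the conjugate alone.\<close>

lemma bregman_eq_conjugate:
  assumes "y \<in> subdifferential \<psi> x"
  shows "bregman \<psi> y x z = fenchel_conjugate \<psi> y + \<psi> z - y \<bullet> z"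
  using fenchel_conjugate_eq[OF assms] by (simp add: bregman_def inner_diff_right)

lemma bregman_nonneg:
  assumes "xs \<in> subdifferential \<psi> x"
  shows "0 \<le> bregman \<psi> xs x z"
  using assms by (auto simp: subdifferential_def bregman_def algebra_simps)

text \<open>The point \<open>x\<close> is a subgradient of the conjugate at \<open>y\<close>. The
  conjugate at \<open>v\<close> is evaluated through a point \<open>u\<close> that has
  \<open>v\<close> as a subgradient.\<close>

lemma fenchel_conjugate_ge:
  fixes \<psi> :: "'a::euclidean_space \<Rightarrow> real"
  assumes "strongly_convex \<mu> \<psi>" "\<mu> > 0" and x: "y \<in> subdifferential \<psi> x"
  shows "fenchel_conjugate \<psi> y + (v - y) \<bullet> x \<le> fenchel_conjugate \<psi> v"
proof -
  obtain u where u: "v \<in> subdifferential \<psi> u"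
    using strongly_convex_subdifferential_surj[OF assms(1,2)] .
  then have "\<psi> u + v \<bullet> (x - u) \<le> \<psi> x" by (auto simp: subdifferential_def)
  then show ?thesis
    by (simp add: fenchel_conjugate_eq[OF u] fenchel_conjugate_eq[OF x] algebra_simps)
qed

text \<open>This is the \<open>1 / \<mu>\<close>-smoothness of the conjugate, obtained without
  differentiating it: the remainder is at most \<open>(v - y) \<bullet> (u - x) - \<mu> / 2 * (norm
  (x - u))\<^sup>2\<close>, and Young's inequality cancels the dependence on
  \<open>u\<close>.\<close>

lemma fenchel_conjugate_le:
  fixes \<psi> :: "'a::euclidean_space \<Rightarrow> real"
  assumes sc: "strongly_convex \<mu> \<psi>" and \<mu>: "\<mu> > 0" and x: "y \<in> subdifferential \<psi> x"
  shows "fenchel_conjugate \<psi> v \<le> fenchel_conjugate \<psi> y + (v - y) \<bullet> x + (norm (v - y))\<^sup>2 / (2 * \<mu>)"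
proof -
  obtain u where u: "v \<in> subdifferential \<psi> u"
    using strongly_convex_subdifferential_surj[OF sc \<mu>] .
  have 1: "\<mu> / 2 * (norm (x - u))\<^sup>2 \<le> \<psi> u - \<psi> x - y \<bullet> (u - x)"
    using strongly_convex_bregman_ge[OF sc x, of u] by (simp add: bregman_def)
  \<comment> \<open>Young's inequality with weight \<open>\<mu>\<close>, read off from the expansion
    of a square.\<close>
  have "0 \<le> (norm ((v - y) - \<mu> *\<^sub>R (u - x)))\<^sup>2 / (2 * \<mu>)" using \<mu> by simp
  also have "\<dots> = ((norm (v - y))\<^sup>2 - 2 * \<mu> * ((v - y) \<bullet> (u - x)) + \<mu>\<^sup>2 * (norm (x - u))\<^sup>2) / (2 * \<mu>)"
    unfolding power2_norm_eq_inner
    by (simp add: inner_diff_left inner_diff_right inner_commute algebra_simps power2_eq_square)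
  also have "\<dots> = (norm (v - y))\<^sup>2 / (2 * \<mu>) - (v - y) \<bullet> (u - x) + \<mu> / 2 * (norm (x - u))\<^sup>2"
    using \<mu> by (simp add: field_simps power2_eq_square)
  finally have 2: "(v - y) \<bullet> (u - x) \<le> (norm (v - y))\<^sup>2 / (2 * \<mu>) + \<mu> / 2 * (norm (x - u))\<^sup>2"
    by simp
  show ?thesis
    using 1 2 by (simp add: fenchel_conjugate_eq[OF u] fenchel_conjugate_eq[OF x] inner_diff_left inner_diff_right)
qed

text \<open>The two preceding bounds squeeze the first-order remainder between 0 and
  \<open>(norm h)\<^sup>2 / (2 * \<mu>)\<close>, which is of smaller order than
  \<open>norm h\<close>.\<close>

lemma gradient_fenchel_conjugate:
  fixes \<psi> :: "'a::euclidean_space \<Rightarrow> real"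
  assumes sc: "strongly_convex \<mu> \<psi>" and \<mu>: "\<mu> > 0" and x: "y \<in> subdifferential \<psi> x"
  shows "gradient (fenchel_conjugate \<psi>) y = x"
proof (rule gradient_eqI)
  let ?c = "fenchel_conjugate \<psi>"
  have bound: "norm (?c (y + h) - ?c y - h \<bullet> x) / norm h \<le> norm h / (2 * \<mu>)" for h
  proof (cases "h = 0")
    case False
    have "norm (?c (y + h) - ?c y - h \<bullet> x) \<le> (norm h)\<^sup>2 / (2 * \<mu>)"
      using fenchel_conjugate_ge[OF assms, of "y + h"] fenchel_conjugate_le[OF assms, of "y + h"]
      by simp
    then have "norm (?c (y + h) - ?c y - h \<bullet> x) / norm h \<le> ((norm h)\<^sup>2 / (2 * \<mu>)) / norm h"
      by (rule divide_right_mono) simp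
    with False show ?thesis by (simp add: power2_eq_square)
  qed simp
  have lim: "((\<lambda>h::'a. norm h / (2 * \<mu>)) \<longlongrightarrow> 0) (at 0)"
    using \<mu> by (auto intro!: tendsto_eq_intros)
  have "((\<lambda>h. norm (?c (y + h) - ?c y - h \<bullet> x) / norm h) \<longlongrightarrow> 0) (at 0)"
    by (rule tendsto_sandwich[OF _ _ tendsto_const lim]) (use bound in auto)
  then show "GDERIV ?c y :> x"
    unfolding gderiv_def has_derivative_at by (simp add: bounded_linear_inner_left)
qed

text \<open>Ensures that after every update the dual iterate is again a subgradient of
  \<open>\<psi>\<close> at the primal iterate.\<close>

lemma mem_subdifferential_gradient_conjugate:
  fixes \<psi> :: "'a::euclidean_space \<Rightarrow> real"
  assumes "strongly_convex \<mu> \<psi>" "\<mu> > 0"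
  shows "y \<in> subdifferential \<psi> (gradient (fenchel_conjugate \<psi>) y)"
  using strongly_convex_subdifferential_surj[OF assms] gradient_fenchel_conjugate[OF assms] by metis

section \<open>Block gradients and the pathwise decrease in one step\<close>

lemma norm_block_grad_le:
  assumes "finite I" "w \<ge> 0" "w * real (card I) \<le> 1"
  shows "(norm (block_grad w f I x))\<^sup>2 \<le> (\<Sum>i\<in>I. w * (norm (gradient (f i) x))\<^sup>2)"
proof -
  \<comment> \<open>Each weight is split into two factors \<open>sqrt w\<close>, so that
    Cauchy-Schwarz leaves the total weight \<open>w * real (card I)\<close> as a separate
    factor.\<close>
  have "norm (block_grad w f I x) \<le> (\<Sum>i\<in>I. sqrt w * (sqrt w * norm (gradient (f i) x)))"
    unfolding block_grad_def using assms(2) by (intro sum_norm_le) (simp add: mult.assoc[symmetric])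
  then have "(norm (block_grad w f I x))\<^sup>2 \<le> (\<Sum>i\<in>I. sqrt w * (sqrt w * norm (gradient (f i) x)))\<^sup>2"
    by (intro power_mono) auto
  also have "\<dots> \<le> (\<Sum>i\<in>I. (sqrt w)\<^sup>2) * (\<Sum>i\<in>I. (sqrt w * norm (gradient (f i) x))\<^sup>2)"
    by (rule Cauchy_Schwarz_ineq_sum)
  also have "\<dots> = (w * real (card I)) * (\<Sum>i\<in>I. w * (norm (gradient (f i) x))\<^sup>2)"
    using assms(2) by (simp add: power_mult_distrib mult.commute)
  also have "\<dots> \<le> 1 * (\<Sum>i\<in>I. w * (norm (gradient (f i) x))\<^sup>2)"
    using assms by (intro mult_right_mono sum_nonneg) auto
  finally show ?thesis by simp
qed

lemma smooth_ratio_le_1: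
  assumes "finite I" "w \<ge> 0" "w * real (card I) \<le> 1"
  shows "smooth_ratio w f I x \<le> 1"
  using norm_block_grad_le[OF assms, of f x] unfolding smooth_ratio_def
  by (intro divide_le_eq_1[THEN iffD2]) (smt (verit) zero_le_power2)

text \<open>Undoes the division in \<open>smooth_ratio\<close>. If the denominator is 0, then
  \<open>norm_block_grad_le\<close> forces the numerator to be 0 as well.\<close>

lemma norm_block_grad_eq_ratio:
  assumes "finite I" "w \<ge> 0" "w * real (card I) \<le> 1"
  shows "(norm (block_grad w f I x))\<^sup>2
    = smooth_ratio w f I x * (\<Sum>i\<in>I. w * (norm (gradient (f i) x))\<^sup>2)"
proof (cases "(\<Sum>i\<in>I. w * (norm (gradient (f i) x))\<^sup>2) = 0")
  case True
  then show ?thesis using norm_block_grad_le[OF assms, of f x] by simp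
qed (simp add: smooth_ratio_def)

text \<open>Weighted sum of the cocoercivity inequalities. Geometrically, every common zero of the
  block lies in the half-space cut out by the block gradient and the offset, onto which the exact
  step projects.\<close>

lemma block_offset_ge:
  fixes f :: "nat \<Rightarrow> 'a::euclidean_space \<Rightarrow> real"
  assumes "w \<ge> 0"
    and "\<And>i. i \<in> I \<Longrightarrow> convex_on UNIV (f i)"
    and "\<And>i y. i \<in> I \<Longrightarrow> f i differentiable (at y)"
    and "\<And>i. i \<in> I \<Longrightarrow> Lip i > 0"
    and "\<And>i. i \<in> I \<Longrightarrow> (Lip i)-lipschitz_on UNIV (gradient (f i))"
    and "\<And>i y. i \<in> I \<Longrightarrow> f i y \<ge> 0"
    and "\<And>i. i \<in> I \<Longrightarrow> f i z = 0"
  shows "block_grad w f I x \<bullet> z \<le> block_offset w Lip f I x"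
proof -
  have "(\<Sum>i\<in>I. w / Lip i * (norm (gradient (f i) x))\<^sup>2) \<le> (\<Sum>i\<in>I. w * (gradient (f i) x \<bullet> (x - z)))"
  proof (rule sum_mono)
    fix i assume i: "i \<in> I"
    have "(norm (gradient (f i) x))\<^sup>2 / Lip i \<le> gradient (f i) x \<bullet> (x - z)"
      using i assms by (intro gradient_cocoercive_at_zero) auto
    from mult_left_mono[OF this assms(1)]
    show "w / Lip i * (norm (gradient (f i) x))\<^sup>2 \<le> w * (gradient (f i) x \<bullet> (x - z))" by simp
  qed
  also have "\<dots> = block_grad w f I x \<bullet> (x - z)"
    by (simp add: block_grad_def inner_sum_left)
  finally show ?thesis by (simp add: block_offset_def inner_diff_right)
qed

text \<open>No probability enters: the block is fixed and \<open>z\<close> is any common zero of its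
  functions. Both stepsizes are handled by comparison with one reference step \<open>u\<close>, the
  minimizer of the quadratic majorant.\<close>

lemma bregman_step_decrease:
  fixes f :: "nat \<Rightarrow> 'a::euclidean_space \<Rightarrow> real"
  defines "S \<equiv> \<lambda>w I x. (\<Sum>i\<in>I. w * (norm (gradient (f i) x))\<^sup>2)"
  assumes sc: "strongly_convex \<mu> \<psi>" and \<mu>: "\<mu> > 0"
    and fin: "finite I" and w: "w > 0" "w * real (card I) \<le> 1"
    and conv: "\<And>i. i \<in> I \<Longrightarrow> convex_on UNIV (f i)"
    and diff: "\<And>i y. i \<in> I \<Longrightarrow> f i differentiable (at y)"
    and Lip: "\<And>i. i \<in> I \<Longrightarrow> Lip i > 0" "\<And>i. i \<in> I \<Longrightarrow> Lip i \<le> Lmax"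
    and lip: "\<And>i. i \<in> I \<Longrightarrow> (Lip i)-lipschitz_on UNIV (gradient (f i))"
    and nonneg: "\<And>i y. i \<in> I \<Longrightarrow> f i y \<ge> 0"
    and zero: "\<And>i. i \<in> I \<Longrightarrow> f i z = 0"
    and Lmax: "Lmax > 0" and ratio: "smooth_ratio w f I x \<le> Lb" and Lb: "Lb > 0"
    and x: "xs \<in> subdifferential \<psi> x"
    and step: "exact_step \<psi> w Lip f I xs x t \<or> adaptive_step \<mu> Lmax w f I x t"
    and x': "xs' = xs - t *\<^sub>R block_grad w f I x" "xs' \<in> subdifferential \<psi> x'"
  shows "bregman \<psi> xs' x' z \<le> bregman \<psi> xs x z - \<mu> / (2 * Lmax\<^sup>2 * Lb) * S w I x"
proof -
  define a where "a = block_grad w f I x"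
  define s where "s = S w I x"
  define r where "r = smooth_ratio w f I x"
  define b where "b = block_offset w Lip f I x"
  let ?c = "fenchel_conjugate \<psi>"
  have s0: "s \<ge> 0" unfolding s_def S_def using w by (intro sum_nonneg) simp
  have a2: "(norm a)\<^sup>2 = r * s"
    unfolding a_def r_def s_def S_def using fin w by (intro norm_block_grad_eq_ratio) auto
  have az: "a \<bullet> z \<le> b"
    unfolding a_def b_def
    by (rule block_offset_ge) (use w conv diff Lip(1) lip nonneg zero in auto)
  have b: "b \<le> a \<bullet> x - s / Lmax"
  proof -
    have "s / Lmax = (\<Sum>i\<in>I. w * (norm (gradient (f i) x))\<^sup>2 / Lmax)"
      by (simp add: s_def S_def sum_divide_distrib)
    also have "\<dots> \<le> (\<Sum>i\<in>I. w / Lip i * (norm (gradient (f i) x))\<^sup>2)"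
    proof (rule sum_mono)
      fix i assume i: "i \<in> I"
      have "w * (norm (gradient (f i) x))\<^sup>2 / Lmax \<le> w * (norm (gradient (f i) x))\<^sup>2 / Lip i"
        using w Lip[OF i] by (intro divide_left_mono) auto
      then show "w * (norm (gradient (f i) x))\<^sup>2 / Lmax \<le> w / Lip i * (norm (gradient (f i) x))\<^sup>2"
        by simp
    qed
    finally show ?thesis by (simp add: b_def block_offset_def a_def)
  qed
  show ?thesis
  proof (cases "s = 0")
    case True
    \<comment> \<open>Here the step length has no effect on the dual iterate, and the Bregman
      distance depends on the primal one only through it.\<close>
    then have "xs' = xs" using a2 x'(1) by (simp add: a_def)
    then have "bregman \<psi> xs' x' z = bregman \<psi> xs x z"
      using x x'(2) by (simp add: bregman_eq_conjugate)
    then show ?thesis using True by (simp add: s_def)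
  next
    case False
    with s0 have s: "s > 0" by simp
    have sL: "s / Lmax > 0" using s Lmax by (rule divide_pos_pos)
    \<comment> \<open>Otherwise \<open>az\<close> and \<open>b\<close> would give
      \<open>0 \<le> - s / Lmax\<close>. It follows that \<open>r\<close> is positive and
      \<open>u\<close> below is a genuine quotient.\<close>
    have "a \<noteq> 0"
    proof
      assume "a = 0"
      with az b sL show False by simp
    qed
    then have "r * s > 0" using a2 by (metis norm_eq_zero zero_less_power2)
    with s have r: "r > 0" by (simp add: zero_less_mult_iff)
    \<comment> \<open>Minimizer over \<open>v\<close> of
      \<open>v\<^sup>2 * (r * s) / (2 * \<mu>) - v * (s / Lmax)\<close>, with minimum
      \<open>- (\<mu> / (2 * Lmax\<^sup>2 * r) * s)\<close>. It is the adaptive step.\<close>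
    define u where "u = \<mu> / (Lmax * r)"
    have u: "u > 0" unfolding u_def using \<mu> Lmax r by simp
    have upper: "?c (xs - u *\<^sub>R a) + u * b \<le> ?c xs - \<mu> / (2 * Lmax\<^sup>2 * r) * s"
    proof -
      have "?c (xs - u *\<^sub>R a) \<le> ?c xs + (xs - u *\<^sub>R a - xs) \<bullet> x + (norm (xs - u *\<^sub>R a - xs))\<^sup>2 / (2 * \<mu>)"
        by (rule fenchel_conjugate_le[OF sc \<mu> x])
      then have "?c (xs - u *\<^sub>R a) \<le> ?c xs - u * (a \<bullet> x) + u\<^sup>2 * (r * s) / (2 * \<mu>)"
        by (simp add: power_mult_distrib a2)
      moreover have "u * b \<le> u * (a \<bullet> x - s / Lmax)" using b u by simp
      moreover have "u\<^sup>2 * (r * s) / (2 * \<mu>) - u * (s / Lmax) = - (\<mu> / (2 * Lmax\<^sup>2 * r) * s)"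
        unfolding u_def using \<mu> Lmax r by (simp add: field_simps power2_eq_square)
      ultimately show ?thesis by (simp add: algebra_simps)
    qed
    have t: "t \<ge> 0" "?c (xs - t *\<^sub>R a) + t * b \<le> ?c (xs - u *\<^sub>R a) + u * b"
    proof -
      have "t \<ge> 0 \<and> ?c (xs - t *\<^sub>R a) + t * b \<le> ?c (xs - u *\<^sub>R a) + u * b"
        using step
      proof
        assume "exact_step \<psi> w Lip f I xs x t"
        then have min: "?c (xs - t *\<^sub>R a) + t * b \<le> ?c (xs - v *\<^sub>R a) + v * b" for v
          unfolding exact_step_def is_arg_min_linorder a_def b_def by simp
        \<comment> \<open>Sign of the exact step: the objective at \<open>t\<close> is at most its
          value at 0 and at least its tangent there, whose slope \<open>b - a \<bullet> x\<close> is
          negative.\<close>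
        have "?c xs + (xs - t *\<^sub>R a - xs) \<bullet> x \<le> ?c (xs - t *\<^sub>R a)"
          by (rule fenchel_conjugate_ge[OF sc \<mu> x])
        with min[of 0] have "t * (b - a \<bullet> x) \<le> 0" by (simp add: algebra_simps)
        moreover have "b - a \<bullet> x < 0" using b sL by linarith
        ultimately have "t \<ge> 0" by (simp add: mult_le_0_iff)
        with min show ?thesis by blast
      next
        assume ad: "adaptive_step \<mu> Lmax w f I x t"
        have "\<exists>i\<in>I. gradient (f i) x \<noteq> 0"
        proof (rule ccontr)
          assume "\<not> ?thesis"
          then have "s = 0" unfolding s_def S_def by simp
          with False show False by simp
        qed
        with ad have "t = u" by (simp add: adaptive_step_def u_def r_def)
        with u show ?thesis by simp
      qed
      then show "t \<ge> 0" "?c (xs - t *\<^sub>R a) + t * b \<le> ?c (xs - u *\<^sub>R a) + u * b" by auto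
    qed
    have "bregman \<psi> xs' x' z = ?c (xs - t *\<^sub>R a) + t * (a \<bullet> z) + (\<psi> z - xs \<bullet> z)"
      using x' by (simp add: bregman_eq_conjugate a_def inner_diff_left)
    \<comment> \<open>The sign of \<open>t\<close> matters here: it turns the half-space inequality
      \<open>az\<close> into an upper bound by the exact-step objective.\<close>
    also have "\<dots> \<le> ?c (xs - t *\<^sub>R a) + t * b + (\<psi> z - xs \<bullet> z)"
      using mult_left_mono[OF az t(1)] by simp
    also have "\<dots> \<le> ?c xs - \<mu> / (2 * Lmax\<^sup>2 * r) * s + (\<psi> z - xs \<bullet> z)"
      using t(2) upper by simp
    also have "\<dots> = bregman \<psi> xs x z - \<mu> / (2 * Lmax\<^sup>2 * r) * s"
      using x by (simp add: bregman_eq_conjugate)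
    also have "\<dots> \<le> bregman \<psi> xs x z - \<mu> / (2 * Lmax\<^sup>2 * Lb) * s"
    proof -
      have "\<mu> / (2 * Lmax\<^sup>2 * Lb) \<le> \<mu> / (2 * Lmax\<^sup>2 * r)"
        using \<mu> Lmax r ratio by (intro divide_left_mono mult_left_mono) (auto simp: r_def)
      from mult_right_mono[OF this s0] show ?thesis by simp
    qed
    finally show ?thesis by (simp add: s_def)
  qed
qed

section \<open>Distance to the solution set and the growth condition\<close>

lemma bregman_dist_sq_le:
  assumes "xs \<in> subdifferential \<psi> x" "z \<in> X"
  shows "bregman_dist_sq \<psi> xs x X \<le> bregman \<psi> xs x z"
  unfolding bregman_dist_sq_def using assms bregman_nonneg
  by (intro cINF_lower bdd_belowI[of _ 0]) auto

lemma bregman_dist_sq_greatest: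
  assumes "X \<noteq> {}" "\<And>z. z \<in> X \<Longrightarrow> c \<le> bregman \<psi> xs x z"
  shows "c \<le> bregman_dist_sq \<psi> xs x X"
  unfolding bregman_dist_sq_def using assms by (rule cINF_greatest)

lemma bregman_dist_sq_nonneg:
  assumes "xs \<in> subdifferential \<psi> x" "X \<noteq> {}"
  shows "0 \<le> bregman_dist_sq \<psi> xs x X"
  using assms bregman_nonneg by (intro bregman_dist_sq_greatest) auto

text \<open>A sum of nonnegative terms vanishes only if each term does, and a common point of the
  sets makes 0 the attained minimum.\<close>

lemma argmin_set_mean_fun:
  assumes "m \<ge> 1" and nonneg: "\<And>i y. i \<in> {1..m} \<Longrightarrow> f i y \<ge> 0"
    and zero: "\<And>i y. i \<in> {1..m} \<Longrightarrow> f i y = 0 \<longleftrightarrow> y \<in> C i"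
    and ne: "(\<Inter>i\<in>{1..m}. C i) \<noteq> {}"
  shows "argmin_set (mean_fun m f) = (\<Inter>i\<in>{1..m}. C i)"
    and "(INF y. mean_fun m f y) = 0"
proof -
  have F0: "mean_fun m f y \<ge> 0" for y
    unfolding mean_fun_def using nonneg by (intro mult_nonneg_nonneg sum_nonneg) auto
  have Fz: "mean_fun m f y = 0 \<longleftrightarrow> y \<in> (\<Inter>i\<in>{1..m}. C i)" for y
  proof -
    have "mean_fun m f y = 0 \<longleftrightarrow> (\<Sum>i\<in>{1..m}. f i y) = 0"
      using \<open>m \<ge> 1\<close> by (simp add: mean_fun_def)
    also have "\<dots> \<longleftrightarrow> (\<forall>i\<in>{1..m}. f i y = 0)"
      using nonneg by (intro sum_nonneg_eq_0_iff) auto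
    finally show ?thesis using zero by auto
  qed
  obtain c where c: "mean_fun m f c = 0" using ne Fz by blast
  show "argmin_set (mean_fun m f) = (\<Inter>i\<in>{1..m}. C i)"
  proof -
    have "y \<in> argmin_set (mean_fun m f) \<longleftrightarrow> mean_fun m f y = 0" for y
    proof
      assume "y \<in> argmin_set (mean_fun m f)"
      then have "mean_fun m f y \<le> mean_fun m f c"
        by (simp add: argmin_set_def is_arg_min_linorder)
      with c F0[of y] show "mean_fun m f y = 0" by simp
    qed (use F0 in \<open>simp add: argmin_set_def is_arg_min_linorder\<close>)
    then show ?thesis using Fz by blast
  qed
  show "(INF y. mean_fun m f y) = 0"
  proof (rule cInf_eq_minimum)
    show "0 \<in> range (mean_fun m f)" using c by (metis rangeI)
  qed (use F0 in auto)
qed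

text \<open>An inequality of Polyak-Lojasiewicz type. Convexity and Cauchy-Schwarz give
  \<open>\<gamma> * d \<le> norm G * norm (x - z)\<close> for each \<open>z\<close> in
  \<open>X\<close>. After squaring, the Bregman distance replaces the norm distance. The infimum
  over \<open>z\<close> then leaves one factor \<open>d\<close> to cancel, and no nearest point has
  to exist.\<close>

lemma growth_gradient_bound:
  fixes f :: "nat \<Rightarrow> 'a::euclidean_space \<Rightarrow> real"
  assumes sc: "strongly_convex \<mu> \<psi>" and \<mu>: "\<mu> > 0" and x: "xs \<in> subdifferential \<psi> x"
    and \<gamma>: "\<gamma> > 0" and ne: "X \<noteq> {}"
    and conv: "\<And>i. i \<in> {1..m} \<Longrightarrow> convex_on UNIV (f i)"
    and diff: "\<And>i y. i \<in> {1..m} \<Longrightarrow> f i differentiable (at y)"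
    and zero: "\<And>i z. i \<in> {1..m} \<Longrightarrow> z \<in> X \<Longrightarrow> f i z = 0"
    and growth: "\<gamma> * bregman_dist_sq \<psi> xs x X \<le> mean_fun m f x"
  shows "\<gamma>\<^sup>2 * \<mu> / 2 * bregman_dist_sq \<psi> xs x X \<le> (norm (block_grad (1 / real m) f {1..m} x))\<^sup>2"
proof -
  define d where "d = bregman_dist_sq \<psi> xs x X"
  define G where "G = block_grad (1 / real m) f {1..m} x"
  have d0: "d \<ge> 0" unfolding d_def using x ne by (rule bregman_dist_sq_nonneg)
  show ?thesis
  proof (cases "d = 0")
    case True then show ?thesis by (simp add: d_def[symmetric])
  next
    case False
    with d0 have d: "d > 0" by simp
    have key: "\<gamma>\<^sup>2 * \<mu> / 2 * d\<^sup>2 \<le> (norm G)\<^sup>2 * bregman \<psi> xs x z" if z: "z \<in> X" for z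
    proof -
      have "mean_fun m f x \<le> (1 / real m) * (\<Sum>i\<in>{1..m}. gradient (f i) x \<bullet> (x - z))"
        unfolding mean_fun_def
      proof (intro mult_left_mono sum_mono)
        fix i assume i: "i \<in> {1..m}"
        have "f i x + gradient (f i) x \<bullet> (z - x) \<le> f i z"
          using conv[OF i] diff[OF i] by (rule convex_gradient_ineq)
        with zero[OF i z] show "f i x \<le> gradient (f i) x \<bullet> (x - z)"
          by (simp add: inner_diff_right)
      qed simp
      also have "\<dots> = G \<bullet> (x - z)"
        by (simp add: G_def block_grad_def inner_sum_left sum_distrib_left)
      also have "\<dots> \<le> norm G * norm (x - z)" by (rule norm_cauchy_schwarz)
      finally have "\<gamma> * d \<le> norm G * norm (x - z)" using growth by (simp add: d_def)
      then have "(\<gamma> * d)\<^sup>2 \<le> (norm G * norm (x - z))\<^sup>2"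
        using \<gamma> d by (intro power_mono) auto
      then have "\<mu> / 2 * (\<gamma> * d)\<^sup>2 \<le> \<mu> / 2 * (norm G * norm (x - z))\<^sup>2"
        using \<mu> by (intro mult_left_mono) auto
      also have "\<dots> = (norm G)\<^sup>2 * (\<mu> / 2 * (norm (x - z))\<^sup>2)"
        by (simp add: power_mult_distrib)
      also have "\<dots> \<le> (norm G)\<^sup>2 * bregman \<psi> xs x z"
        using strongly_convex_bregman_ge[OF sc x] by (intro mult_left_mono) auto
      finally show ?thesis by (simp add: power_mult_distrib mult_ac)
    qed
    \<comment> \<open>Allows division by the squared norm before the infimum is taken; a zero
      gradient would contradict \<open>key\<close> because \<open>d\<close> is positive.\<close>
    have G: "(norm G)\<^sup>2 > 0"
    proof (rule ccontr)
      assume "\<not> (norm G)\<^sup>2 > 0"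
      then have "(norm G)\<^sup>2 = 0" by simp
      moreover obtain z where "z \<in> X" using ne by blast
      moreover have "\<gamma>\<^sup>2 * \<mu> / 2 * d\<^sup>2 > 0" using \<gamma> \<mu> d by simp
      ultimately show False using key[of z] by simp
    qed
    have "\<gamma>\<^sup>2 * \<mu> / 2 * d\<^sup>2 / (norm G)\<^sup>2 \<le> bregman_dist_sq \<psi> xs x X"
    proof (rule bregman_dist_sq_greatest[OF ne])
      fix z assume "z \<in> X"
      from key[OF this] show "\<gamma>\<^sup>2 * \<mu> / 2 * d\<^sup>2 / (norm G)\<^sup>2 \<le> bregman \<psi> xs x z"
        unfolding pos_divide_le_eq[OF G] by (simp only: mult.commute)
    qed
    then have "\<gamma>\<^sup>2 * \<mu> / 2 * d\<^sup>2 / (norm G)\<^sup>2 \<le> d" by (simp add: d_def)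
    then have "\<gamma>\<^sup>2 * \<mu> / 2 * d * d \<le> (norm G)\<^sup>2 * d"
      using G by (simp add: pos_divide_le_eq power2_eq_square mult_ac)
    with d have "\<gamma>\<^sup>2 * \<mu> / 2 * d \<le> (norm G)\<^sup>2" by simp
    then show ?thesis by (simp add: d_def G_def)
  qed
qed

section \<open>Dependence on past samples, and expectations over the next block\<close>

text \<open>Stands in for measurability with respect to the samples before step \<open>k\<close>.
  Since only finitely many histories occur, measurability and integrability of real functions of
  this kind can be derived instead of being assumed for the iterates.\<close>

definition determined_before :: "'w set \<Rightarrow> (nat \<Rightarrow> 'w \<Rightarrow> 'b) \<Rightarrow> nat \<Rightarrow> ('w \<Rightarrow> 'c) \<Rightarrow> bool" where
  "determined_before \<Omega> J k Y \<longleftrightarrow>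
    (\<forall>\<omega>\<in>\<Omega>. \<forall>\<omega>'\<in>\<Omega>. (\<forall>j<k. J j \<omega> = J j \<omega>') \<longrightarrow> Y \<omega> = Y \<omega>')"

lemma determined_before_compose:
  assumes "determined_before \<Omega> J k Y" "determined_before \<Omega> J k Z"
  shows "determined_before \<Omega> J k (\<lambda>\<omega>. h (Y \<omega>) (Z \<omega>))"
  using assms unfolding determined_before_def by metis

text \<open>The index shifts by one: the stepsize \<open>t k\<close> may use the block
  \<open>J k\<close>, but it first affects the iterate with index \<open>Suc k\<close>. Thus
  \<open>x k\<close> and \<open>xs k\<close> involve only blocks before \<open>J k\<close>.\<close>

lemma sbbp_determined_before:
  assumes "sbbp \<Omega> \<psi> w f J t x0 xs0 x xs" "non_anticipating \<Omega> J t"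
  shows "determined_before \<Omega> J k (x k) \<and> determined_before \<Omega> J k (xs k)"
proof (induction k)
  case 0
  then show ?case using assms(1) unfolding determined_before_def sbbp_def by simp
next
  case (Suc k)
  have "xs (Suc k) \<omega> = xs (Suc k) \<omega>' \<and> x (Suc k) \<omega> = x (Suc k) \<omega>'"
    if \<omega>: "\<omega> \<in> \<Omega>" "\<omega>' \<in> \<Omega>" and eq: "\<forall>j<Suc k. J j \<omega> = J j \<omega>'" for \<omega> \<omega>'
  proof -
    have "t k \<omega> = t k \<omega>'" using assms(2) \<omega> eq unfolding non_anticipating_def less_Suc_eq_le by blast
    moreover have "x k \<omega> = x k \<omega>'" "xs k \<omega> = xs k \<omega>'"
      using Suc \<omega> eq unfolding determined_before_def by (metis less_SucI)+
    moreover have "J k \<omega> = J k \<omega>'" using eq by simp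
    ultimately show ?thesis using assms(1) \<omega> unfolding sbbp_def by metis
  qed
  then show ?case unfolding determined_before_def by blast
qed

text \<open>Only finitely many sample histories are possible, so \<open>Y\<close> is a finite combination of
  indicators of the events \<open>A h\<close> that the history is \<open>h\<close>.\<close>

lemma determined_before_expectation:
  fixes Y :: "'w \<Rightarrow> real"
  assumes M: "prob_space M" and bs: "block_sampling M m \<tau> P J"
    and det: "determined_before (space M) J k Y" and i: "i \<in> {1..m}"
  shows "integrable M Y"
    and "integrable M (\<lambda>\<omega>. Y \<omega> * indicator {\<omega>. i \<in> J k \<omega>} \<omega>)"
    and "prob_space.expectation M (\<lambda>\<omega>. Y \<omega> * indicator {\<omega>. i \<in> J k \<omega>} \<omega>)
      = real \<tau> / real m * prob_space.expectation M Y"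
proof -
  interpret prob_space M by (rule M)
  have indep: "indep_vars (\<lambda>_. count_space UNIV) J UNIV"
    and distr: "\<And>j. distr M (count_space UNIV) (J j) = measure_pmf P"
    and J: "\<And>j \<omega>. \<omega> \<in> space M \<Longrightarrow> J j \<omega> \<subseteq> {1..m}"
    and P: "measure_pmf.prob P {I. i \<in> I} = real \<tau> / real m"
    using bs i unfolding block_sampling_def by auto
  have meas: "J j \<in> measurable M (count_space UNIV)" for j
    using indep by (auto simp: indep_vars_def2)
  define E where "E = {\<omega>\<in>space M. i \<in> J k \<omega>}"
  have E_vimage: "E = J k -` {I. i \<in> I} \<inter> space M" by (auto simp: E_def)
  have E[measurable]: "E \<in> events" unfolding E_vimage by (rule measurable_sets[OF meas]) simp
  have probE: "prob E = real \<tau> / real m"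
  proof -
    have "measure (distr M (count_space UNIV) (J k)) {I. i \<in> I} = prob E"
      unfolding E_vimage by (rule measure_distr[OF meas]) simp
    then show ?thesis using distr P by simp
  qed
  \<comment> \<open>Histories are extensional functions, so agreement below \<open>k\<close> is
    equality and each sample point lies in \<open>A h\<close> for exactly one \<open>h\<close> in
    \<open>H\<close>.\<close>
  define H :: "(nat \<Rightarrow> nat set) set" where "H = {..<k} \<rightarrow>\<^sub>E Pow {1..m}"
  define hist where "hist \<omega> = (\<lambda>j\<in>{..<k}. J j \<omega>)" for \<omega>
  define A where "A h = {\<omega>\<in>space M. \<forall>j<k. J j \<omega> = h j}" for h
  have fH: "finite H" unfolding H_def by (intro finite_PiE) auto
  have "{\<omega>\<in>space M. J j \<omega> = v} \<in> events" for j v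
  proof -
    have "J j -` {v} \<inter> space M \<in> events" by (rule measurable_sets[OF meas]) simp
    moreover have "J j -` {v} \<inter> space M = {\<omega>\<in>space M. J j \<omega> = v}" by auto
    ultimately show ?thesis by simp
  qed
  then have A[measurable]: "A h \<in> events" for h
    unfolding A_def by (intro sets.sets_Collect_countable_All sets.sets_Collect_imp) auto
  have A_hist: "\<omega> \<in> A h \<longleftrightarrow> h = hist \<omega>" if "\<omega> \<in> space M" "h \<in> H" for \<omega> h
    using that unfolding A_def hist_def H_def
    by (auto simp: fun_eq_iff PiE_def extensional_def restrict_def)
  have hist: "hist \<omega> \<in> H" if "\<omega> \<in> space M" for \<omega>
    using J[OF that] unfolding hist_def H_def by auto
  have prob: "prob (A h \<inter> E) = prob (A h) * prob E" for h
  proof -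
    have indep_prod: "prob (\<Inter>j\<in>{..k}. J j -` B j \<inter> space M) = (\<Prod>j\<in>{..k}. prob (J j -` B j \<inter> space M))" for B
      using indep by (rule indep_varsD) auto
    \<comment> \<open>One family serves two events: \<open>T = UNIV\<close> gives the probability of
      the history alone, and \<open>T = {I. i \<in> I}\<close> that of the history together with
      \<open>E\<close>.\<close>
    define B where "B T j = (if j = k then T else {h j})" for T j
    have *: "prob (A h \<inter> (J k -` T \<inter> space M))
        = (\<Prod>j<k. prob (J j -` {h j} \<inter> space M)) * prob (J k -` T \<inter> space M)" for T
    proof -
      have "A h \<inter> (J k -` T \<inter> space M) = (\<Inter>j\<in>{..k}. J j -` B T j \<inter> space M)"
      proof (intro equalityI subsetI)
        fix \<omega> assume \<omega>: "\<omega> \<in> (\<Inter>j\<in>{..k}. J j -` B T j \<inter> space M)"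
        then have mem: "J j \<omega> \<in> B T j" if "j \<le> k" for j using that by blast
        have "J k \<omega> \<in> T" using mem[of k] by (simp add: B_def)
        moreover have "J j \<omega> = h j" if "j < k" for j using mem[of j] that by (simp add: B_def)
        moreover have "\<omega> \<in> space M" using \<omega> by blast
        ultimately
        show "\<omega> \<in> A h \<inter> (J k -` T \<inter> space M)" by (auto simp: A_def)
      qed (auto simp: A_def B_def)
      moreover have "(\<Prod>j\<in>{..k}. prob (J j -` B T j \<inter> space M))
          = (\<Prod>j<k. prob (J j -` {h j} \<inter> space M)) * prob (J k -` T \<inter> space M)"
        by (simp add: lessThan_Suc_atMost[symmetric] B_def)
      ultimately show ?thesis using indep_prod[of "B T"] by simp
    qed
    have "prob (A h) = (\<Prod>j<k. prob (J j -` {h j} \<inter> space M))"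
      using *[of UNIV] by (simp add: prob_space Int_absorb2 sets.sets_into_space)
    with *[of "{I. i \<in> I}"] show ?thesis by (simp add: E_vimage)
  qed
  \<comment> \<open>The common value of \<open>Y\<close> on \<open>A h\<close>. For an empty
    \<open>A h\<close> the choice is arbitrary, but there the indicator is 0.\<close>
  define y where "y h = (SOME v. \<exists>\<omega>\<in>A h. v = Y \<omega>)" for h
  have y: "y (hist \<omega>) = Y \<omega>" if \<omega>: "\<omega> \<in> space M" for \<omega>
  proof -
    have "\<omega> \<in> A (hist \<omega>)" using A_hist hist \<omega> by blast
    then have "\<exists>\<omega>'\<in>A (hist \<omega>). y (hist \<omega>) = Y \<omega>'"
      unfolding y_def by (intro someI_ex[of "\<lambda>v. \<exists>\<omega>'\<in>A (hist \<omega>). v = Y \<omega>'"]) blast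
    then obtain \<omega>' where \<omega>': "\<omega>' \<in> A (hist \<omega>)" "y (hist \<omega>) = Y \<omega>'" by blast
    have "\<omega>' \<in> space M" "\<forall>j<k. J j \<omega> = J j \<omega>'"
      using \<omega>'(1) by (auto simp: A_def hist_def)
    then have "Y \<omega> = Y \<omega>'" using det \<omega> unfolding determined_before_def by blast
    then show ?thesis using \<omega>' by simp
  qed
  have Y: "Y \<omega> = (\<Sum>h\<in>H. y h * indicator (A h) \<omega>)" if "\<omega> \<in> space M" for \<omega>
  proof -
    have "(\<Sum>h\<in>H. y h * indicator (A h) \<omega>) = (\<Sum>h\<in>H. if hist \<omega> = h then y h else 0)"
      using A_hist[OF that] by (intro sum.cong) (auto simp: indicator_def)
    also have "\<dots> = Y \<omega>" using fH hist[OF that] y[OF that] by simp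
    finally show ?thesis by simp
  qed
  have YE: "Y \<omega> * indicator {\<omega>. i \<in> J k \<omega>} \<omega> = (\<Sum>h\<in>H. y h * indicator (A h \<inter> E) \<omega>)"
    if "\<omega> \<in> space M" for \<omega>
    using that by (auto simp: Y sum_distrib_right E_def indicator_def intro!: sum.cong)
  have int: "integrable M (\<lambda>\<omega>. \<Sum>h\<in>H. y h * indicator (B h) \<omega>)" if "\<And>h. B h \<in> events" for B
    using that by (intro Bochner_Integration.integrable_sum integrable_mult_right integrable_real_indicator)
      (auto simp: emeasure_eq_measure)
  have ex: "expectation (\<lambda>\<omega>. \<Sum>h\<in>H. y h * indicator (B h) \<omega>) = (\<Sum>h\<in>H. y h * prob (B h))"
    if B: "\<And>h. B h \<in> events" for B
  proof -
    have "expectation (\<lambda>\<omega>. \<Sum>h\<in>H. y h * indicator (B h) \<omega>)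
        = (\<Sum>h\<in>H. expectation (\<lambda>\<omega>. y h * indicator (B h) \<omega>))"
      using B by (intro Bochner_Integration.integral_sum integrable_mult_right integrable_real_indicator)
        (auto simp: emeasure_eq_measure)
    also have "\<dots> = (\<Sum>h\<in>H. y h * prob (B h))"
      using B by (intro sum.cong) (auto simp: Int_absorb2 sets.sets_into_space)
    finally show ?thesis .
  qed
  show "integrable M Y"
    using int[of A, OF A] by (subst Bochner_Integration.integrable_cong[OF refl Y]) auto
  show "integrable M (\<lambda>\<omega>. Y \<omega> * indicator {\<omega>. i \<in> J k \<omega>} \<omega>)"
    by (subst Bochner_Integration.integrable_cong[OF refl YE]) (use int[of "\<lambda>h. A h \<inter> E"] in auto)
  have "expectation (\<lambda>\<omega>. Y \<omega> * indicator {\<omega>. i \<in> J k \<omega>} \<omega>) = (\<Sum>h\<in>H. y h * prob (A h \<inter> E))"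
    by (subst Bochner_Integration.integral_cong[OF refl YE]) (use ex[of "\<lambda>h. A h \<inter> E"] in auto)
  also have "\<dots> = real \<tau> / real m * (\<Sum>h\<in>H. y h * prob (A h))"
    by (simp add: prob probE sum_distrib_left mult_ac)
  also have "(\<Sum>h\<in>H. y h * prob (A h)) = expectation Y"
  proof -
    have "expectation Y = expectation (\<lambda>\<omega>. \<Sum>h\<in>H. y h * indicator (A h) \<omega>)"
      by (intro Bochner_Integration.integral_cong refl Y)
    also have "\<dots> = (\<Sum>h\<in>H. y h * prob (A h))" by (rule ex[of A, OF A])
    finally show ?thesis by simp
  qed
  finally show "expectation (\<lambda>\<omega>. Y \<omega> * indicator {\<omega>. i \<in> J k \<omega>} \<omega>)
      = real \<tau> / real m * expectation Y" .
qed

text \<open>The block average is unbiased. Indicators turn the random index set into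
  \<open>{1..m}\<close>, and each index contributes \<open>1 / real \<tau>\<close> times its
  inclusion probability \<open>real \<tau> / real m\<close>, which is
  \<open>1 / real m\<close>.\<close>

lemma expectation_block_sum:
  fixes y :: "nat \<Rightarrow> 'w \<Rightarrow> real"
  assumes M: "prob_space M" and bs: "block_sampling M m \<tau> P J" and \<tau>: "\<tau> \<in> {1..m}"
    and det: "\<And>i. i \<in> {1..m} \<Longrightarrow> determined_before (space M) J k (y i)"
  shows "integrable M (\<lambda>\<omega>. \<Sum>i\<in>J k \<omega>. (1 / real \<tau>) * y i \<omega>)"
    and "prob_space.expectation M (\<lambda>\<omega>. \<Sum>i\<in>J k \<omega>. (1 / real \<tau>) * y i \<omega>)
      = prob_space.expectation M (\<lambda>\<omega>. \<Sum>i\<in>{1..m}. (1 / real m) * y i \<omega>)"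
proof -
  interpret prob_space M by (rule M)
  let ?g = "\<lambda>i \<omega>. (1 / real \<tau>) * (y i \<omega> * indicator {\<omega>. i \<in> J k \<omega>} \<omega>)"
  note dbe = determined_before_expectation[OF M bs det]
  have eq: "(\<Sum>i\<in>J k \<omega>. (1 / real \<tau>) * y i \<omega>) = (\<Sum>i\<in>{1..m}. ?g i \<omega>)" if "\<omega> \<in> space M" for \<omega>
  proof -
    have "J k \<omega> \<subseteq> {1..m}" using bs that unfolding block_sampling_def by blast
    then show ?thesis
      by (intro sum.mono_neutral_cong_left) (auto simp: indicator_def)
  qed
  have int: "integrable M (?g i)" if "i \<in> {1..m}" for i
    using dbe(2)[OF that that] by (rule integrable_mult_right)
  show "integrable M (\<lambda>\<omega>. \<Sum>i\<in>J k \<omega>. (1 / real \<tau>) * y i \<omega>)"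
    by (subst Bochner_Integration.integrable_cong[OF refl eq]) (use int in auto)
  have "expectation (\<lambda>\<omega>. \<Sum>i\<in>J k \<omega>. (1 / real \<tau>) * y i \<omega>) = (\<Sum>i\<in>{1..m}. expectation (?g i))"
    by (subst Bochner_Integration.integral_cong[OF refl eq])
      (use int Bochner_Integration.integral_sum[of "{1..m}" M ?g] in auto)
  also have "\<dots> = (\<Sum>i\<in>{1..m}. expectation (\<lambda>\<omega>. (1 / real m) * y i \<omega>))"
    using dbe(3) \<tau> by (intro sum.cong) auto
  also have "\<dots> = expectation (\<lambda>\<omega>. \<Sum>i\<in>{1..m}. (1 / real m) * y i \<omega>)"
    using dbe(1) by (intro Bochner_Integration.integral_sum[symmetric] integrable_mult_right) auto
  finally show "expectation (\<lambda>\<omega>. \<Sum>i\<in>J k \<omega>. (1 / real \<tau>) * y i \<omega>)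
    = expectation (\<lambda>\<omega>. \<Sum>i\<in>{1..m}. (1 / real m) * y i \<omega>)" .
qed

text \<open>The rate \<open>c\<close> may be negative, but then all terms vanish.\<close>

lemma linear_rate_iterate:
  fixes e :: "nat \<Rightarrow> real"
  assumes nonneg: "\<And>k. 0 \<le> e k" and step: "\<And>k. e (Suc k) \<le> c * e k"
  shows "e k \<le> c ^ k * e 0"
proof (cases "c < 0")
  case True
  have "e k = 0" for k
  proof -
    \<comment> \<open>The next term is nonnegative and at most \<open>c * e k\<close>, which a
      negative \<open>c\<close> permits only for \<open>e k = 0\<close>.\<close>
    have "0 \<le> c * e k" using nonneg[of "Suc k"] step[of k] by linarith
    with True nonneg[of k] show ?thesis by (simp add: zero_le_mult_iff)
  qed
  then show ?thesis by simp
next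
  case False
  show ?thesis
  proof (induction k)
    case (Suc k)
    have "e (Suc k) \<le> c * e k" by (rule step)
    also have "\<dots> \<le> c * (c ^ k * e 0)" using Suc False by (intro mult_left_mono) auto
    finally show ?case by simp
  qed simp
qed

section \<open>Assembly: pathwise decrease, growth, expectation and iteration\<close>

theorem theorem5:
  fixes C :: "nat \<Rightarrow> (real ^ 'n) set"
    and \<psi> :: "real ^ 'n \<Rightarrow> real"
    and f :: "nat \<Rightarrow> real ^ 'n \<Rightarrow> real"
    and Lip :: "nat \<Rightarrow> real"
    and m \<tau> :: nat
    and \<mu> \<gamma> Lmax L Lblock :: real
    and M :: "'w measure"
    and P :: "nat set pmf"
    and J :: "nat \<Rightarrow> 'w \<Rightarrow> nat set"
    and t :: "nat \<Rightarrow> 'w \<Rightarrow> real"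
    and x0 xs0 :: "real ^ 'n"
    and x xs :: "nat \<Rightarrow> 'w \<Rightarrow> real ^ 'n"
    and F :: "real ^ 'n \<Rightarrow> real"
    and Xbar :: "(real ^ 'n) set"
  assumes "\<And>i. i \<in> {1..m} \<Longrightarrow> closed (C i)"
    and "\<And>i. i \<in> {1..m} \<Longrightarrow> convex (C i)"
    and "(\<Inter>i\<in>{1..m}. C i) \<noteq> {}"
    and "\<mu> > 0" and "strongly_convex \<mu> \<psi>"
    and "\<And>i. i \<in> {1..m} \<Longrightarrow> convex_on UNIV (f i)"
    and "\<And>i y. i \<in> {1..m} \<Longrightarrow> f i differentiable (at y)"
    and "\<And>i. i \<in> {1..m} \<Longrightarrow> Lip i > 0"
    and "\<And>i. i \<in> {1..m} \<Longrightarrow> (Lip i)-lipschitz_on UNIV (gradient (f i))"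
    and "\<And>i y. i \<in> {1..m} \<Longrightarrow> f i y \<ge> 0"
    and "\<And>i y. i \<in> {1..m} \<Longrightarrow> f i y = 0 \<longleftrightarrow> y \<in> C i"
    and "Lmax = Max (Lip ` {1..m})"
    and "F = mean_fun m f" and "Xbar = argmin_set F"
    and "\<tau> \<in> {1..m}" and "prob_space M" and "block_sampling M m \<tau> P J"
    and "sbbp (space M) \<psi> (1 / real \<tau>) f J t x0 xs0 x xs"
    and "(\<forall>k. \<forall>\<omega>\<in>space M. exact_step \<psi> (1 / real \<tau>) Lip f (J k \<omega>) (xs k \<omega>) (x k \<omega>) (t k \<omega>)) \<or>
         (\<forall>k. \<forall>\<omega>\<in>space M. adaptive_step \<mu> Lmax (1 / real \<tau>) f (J k \<omega>) (x k \<omega>) (t k \<omega>))"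
    and "non_anticipating (space M) J t"
    and "\<gamma> > 0" and "bregman_growth \<psi> F \<gamma>"
    and "L = stochastic_regularity m f" and "L \<in> {0<..1}"
    and "Lblock = block_regularity (space M) \<tau> f J x" and "Lblock \<in> {0<..1}"
  shows "\<forall>k. integrable M (\<lambda>\<omega>. bregman_dist_sq \<psi> (xs k \<omega>) (x k \<omega>) Xbar) \<and>
    prob_space.expectation M (\<lambda>\<omega>. bregman_dist_sq \<psi> (xs k \<omega>) (x k \<omega>) Xbar)
      \<le> (1 - \<gamma>\<^sup>2 * \<mu>\<^sup>2 / (4 * Lmax\<^sup>2 * Lblock * L)) ^ k * bregman_dist_sq \<psi> xs0 x0 Xbar"
proof -
  note fconv = assms(6) and fdiff = assms(7) and Lip = assms(8) and lip = assms(9)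
    and fnonneg = assms(10) and fzero = assms(11) and sc = assms(5) and \<mu> = assms(4)
    and M = assms(16) and bs = assms(17) and sb = assms(18) and \<tau> = assms(15)
  interpret prob_space M by (rule M)
  define S where "S w I v = (\<Sum>i\<in>I. w * (norm (gradient (f i) v))\<^sup>2)" for w :: real and I v
  define d where "d k \<omega> = bregman_dist_sq \<psi> (xs k \<omega>) (x k \<omega>) Xbar" for k \<omega>
  have m: "m \<ge> 1" using \<tau> by simp
  have Xbar: "Xbar = (\<Inter>i\<in>{1..m}. C i)" and Fmin: "(INF y. F y) = 0"
    using argmin_set_mean_fun[OF m fnonneg fzero assms(3)] assms(13,14) by auto
  have ne: "Xbar \<noteq> {}" using Xbar assms(3) by simp
  have zero: "f i z = 0" if "i \<in> {1..m}" "z \<in> Xbar" for i z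
    using that fzero Xbar by auto
  have Lmax: "Lip i \<le> Lmax" if "i \<in> {1..m}" for i
    using that assms(12) by simp
  have Lmax0: "Lmax > 0" using Lip[of 1] Lmax[of 1] m by simp
  have J: "J k \<omega> \<subseteq> {1..m}" "card (J k \<omega>) = \<tau>" if "\<omega> \<in> space M" for k \<omega>
    using bs that unfolding block_sampling_def by auto
  have finJ: "finite (J k \<omega>)" if "\<omega> \<in> space M" for k \<omega>
    using J(1)[OF that] by (rule finite_subset) simp
  have sub: "xs k \<omega> \<in> subdifferential \<psi> (x k \<omega>)" if \<omega>: "\<omega> \<in> space M" for k \<omega>
  proof (cases k)
    case 0
    then show ?thesis using sb \<omega> unfolding sbbp_def by simp
  next
    case (Suc j)
    then have "x k \<omega> = gradient (fenchel_conjugate \<psi>) (xs k \<omega>)" using sb \<omega> unfolding sbbp_def by blast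
    then show ?thesis using mem_subdifferential_gradient_conjugate[OF sc \<mu>] by simp
  qed
  \<comment> \<open>All ratios are at most 1, since the weights on a block sum to 1. The set is
    therefore bounded above, and its real supremum is a genuine upper bound.\<close>
  have ratio: "smooth_ratio (1 / real \<tau>) f (J k \<omega>) (x k \<omega>) \<le> Lblock" if \<omega>: "\<omega> \<in> space M" for k \<omega>
  proof -
    have "bdd_above ((\<lambda>(k, \<omega>). smooth_ratio (1 / real \<tau>) f (J k \<omega>) (x k \<omega>)) ` (UNIV \<times> space M))"
      using J finJ \<tau> by (intro bdd_aboveI[of _ 1]) (auto intro!: smooth_ratio_le_1)
    then show ?thesis
      unfolding assms(25) block_regularity_def
      by (rule cSUP_upper2[of _ _ "(k, \<omega>)"]) (use \<omega> in auto)
  qed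
  have ratioL: "smooth_ratio (1 / real m) f {1..m} v \<le> L" for v
  proof -
    have "bdd_above (range (\<lambda>v. smooth_ratio (1 / real m) f {1..m} v))"
      by (intro bdd_aboveI[of _ 1]) (auto intro!: smooth_ratio_le_1)
    then show ?thesis
      unfolding assms(23) stochastic_regularity_def by (rule cSUP_upper2) auto
  qed
  have decrease: "d (Suc k) \<omega> \<le> d k \<omega> - \<mu> / (2 * Lmax\<^sup>2 * Lblock) * S (1 / real \<tau>) (J k \<omega>) (x k \<omega>)"
    if \<omega>: "\<omega> \<in> space M" for k \<omega>
  proof -
    \<comment> \<open>With the gain moved to the left, the bound holds for every \<open>z\<close> in
      \<open>Xbar\<close> and passes to the infimum.\<close>
    have "d (Suc k) \<omega> + \<mu> / (2 * Lmax\<^sup>2 * Lblock) * S (1 / real \<tau>) (J k \<omega>) (x k \<omega>)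
        \<le> bregman \<psi> (xs k \<omega>) (x k \<omega>) z" if z: "z \<in> Xbar" for z
    proof -
      have "bregman \<psi> (xs (Suc k) \<omega>) (x (Suc k) \<omega>) z
          \<le> bregman \<psi> (xs k \<omega>) (x k \<omega>) z
            - \<mu> / (2 * Lmax\<^sup>2 * Lblock) * (\<Sum>i\<in>J k \<omega>. (1 / real \<tau>) * (norm (gradient (f i) (x k \<omega>)))\<^sup>2)"
      proof (rule bregman_step_decrease[OF sc \<mu> finJ[OF \<omega>]])
        have I: "i \<in> {1..m}" if "i \<in> J k \<omega>" for i using J(1)[OF \<omega>] that by blast
        show "convex_on UNIV (f i)" "f i differentiable (at y)" "Lip i > 0" "Lip i \<le> Lmax"
          "(Lip i)-lipschitz_on UNIV (gradient (f i))" "f i y \<ge> 0" "f i z = 0"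
          if "i \<in> J k \<omega>" for i y
          using I[OF that] fconv fdiff Lip Lmax lip fnonneg zero z by auto
        show "1 / real \<tau> > 0" using \<tau> by simp
        show "1 / real \<tau> * real (card (J k \<omega>)) \<le> 1" using J(2)[OF \<omega>] by simp
        show "Lmax > 0" by (rule Lmax0)
        show "smooth_ratio (1 / real \<tau>) f (J k \<omega>) (x k \<omega>) \<le> Lblock" by (rule ratio[OF \<omega>])
        show "Lblock > 0" using assms(26) by simp
        show "xs k \<omega> \<in> subdifferential \<psi> (x k \<omega>)"
          "xs (Suc k) \<omega> \<in> subdifferential \<psi> (x (Suc k) \<omega>)" using sub \<omega> by auto
        show "exact_step \<psi> (1 / real \<tau>) Lip f (J k \<omega>) (xs k \<omega>) (x k \<omega>) (t k \<omega>)
          \<or> adaptive_step \<mu> Lmax (1 / real \<tau>) f (J k \<omega>) (x k \<omega>) (t k \<omega>)"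
          using assms(19) \<omega> by blast
        show "xs (Suc k) \<omega> = xs k \<omega> - t k \<omega> *\<^sub>R block_grad (1 / real \<tau>) f (J k \<omega>) (x k \<omega>)"
          using sb \<omega> unfolding sbbp_def by blast
      qed
      moreover have "d (Suc k) \<omega> \<le> bregman \<psi> (xs (Suc k) \<omega>) (x (Suc k) \<omega>) z"
        unfolding d_def using sub[OF \<omega>] z by (rule bregman_dist_sq_le)
      ultimately show ?thesis unfolding S_def by linarith
    qed
    from bregman_dist_sq_greatest[OF ne this] show ?thesis
      unfolding d_def[of k] by simp
  qed
  have gain: "\<gamma>\<^sup>2 * \<mu> / (2 * L) * d k \<omega> \<le> S (1 / real m) {1..m} (x k \<omega>)"
    if \<omega>: "\<omega> \<in> space M" for k \<omega>
  proof -
    \<comment> \<open>The growth condition at the current pair of iterates, with minimum value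
      0.\<close>
    have "\<gamma> * d k \<omega> \<le> mean_fun m f (x k \<omega>)"
      using assms(22) sub[OF \<omega>] Fmin unfolding bregman_growth_def d_def assms(13,14)
      by fastforce
    then have "\<gamma>\<^sup>2 * \<mu> / 2 * d k \<omega> \<le> (norm (block_grad (1 / real m) f {1..m} (x k \<omega>)))\<^sup>2"
      unfolding d_def using sc \<mu> sub[OF \<omega>] assms(21) ne fconv fdiff zero
      by (intro growth_gradient_bound) auto
    also have "\<dots> = smooth_ratio (1 / real m) f {1..m} (x k \<omega>) * S (1 / real m) {1..m} (x k \<omega>)"
      unfolding S_def by (intro norm_block_grad_eq_ratio) auto
    also have "\<dots> \<le> L * S (1 / real m) {1..m} (x k \<omega>)"
      unfolding S_def by (intro mult_right_mono ratioL sum_nonneg) auto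
    finally show ?thesis using assms(24) by (simp add: field_simps)
  qed
  have det: "determined_before (space M) J k (x k)" "determined_before (space M) J k (xs k)" for k
    using sbbp_determined_before[OF sb assms(20)] by auto
  have detd: "determined_before (space M) J k (d k)" for k
    unfolding d_def
    using determined_before_compose[OF det(2) det(1), of k "\<lambda>a b. bregman_dist_sq \<psi> a b Xbar"] .
  have intd: "integrable M (d k)" for k
    using determined_before_expectation(1)[OF M bs detd, of 1] m by simp
  let ?q = "\<gamma>\<^sup>2 * \<mu>\<^sup>2 / (4 * Lmax\<^sup>2 * Lblock * L)"
  have step: "expectation (d (Suc k)) \<le> (1 - ?q) * expectation (d k)" for k
  proof -
    define c where "c = \<mu> / (2 * Lmax\<^sup>2 * Lblock)"
    have c: "c \<ge> 0" unfolding c_def using \<mu> assms(26) by simp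
    have detg: "determined_before (space M) J k (\<lambda>\<omega>. (norm (gradient (f i) (x k \<omega>)))\<^sup>2)" for i
      using determined_before_compose[OF det(1) det(1), of k "\<lambda>a b. (norm (gradient (f i) a))\<^sup>2"] .
    \<comment> \<open>The squared gradient norms at \<open>x k\<close> depend only on earlier
      blocks, so averaging over the fresh block \<open>J k\<close> gives the full average in
      expectation.\<close>
    have intS: "integrable M (\<lambda>\<omega>. S (1 / real \<tau>) (J k \<omega>) (x k \<omega>))"
      and ES: "expectation (\<lambda>\<omega>. S (1 / real \<tau>) (J k \<omega>) (x k \<omega>))
        = expectation (\<lambda>\<omega>. S (1 / real m) {1..m} (x k \<omega>))"
      using expectation_block_sum[OF M bs \<tau> detg] unfolding S_def by auto
    have intSm: "integrable M (\<lambda>\<omega>. S (1 / real m) {1..m} (x k \<omega>))"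
      using determined_before_expectation(1)[OF M bs
          determined_before_compose[OF det(1) det(1), of k "\<lambda>a b. S (1 / real m) {1..m} a"], of 1] m
      by simp
    have "expectation (d (Suc k)) \<le> expectation (\<lambda>\<omega>. d k \<omega> - c * S (1 / real \<tau>) (J k \<omega>) (x k \<omega>))"
      using intd intS decrease unfolding c_def by (intro integral_mono) auto
    also have "\<dots> = expectation (d k) - c * expectation (\<lambda>\<omega>. S (1 / real m) {1..m} (x k \<omega>))"
      using intd intS ES by simp
    also have "\<dots> \<le> expectation (d k) - c * (\<gamma>\<^sup>2 * \<mu> / (2 * L) * expectation (d k))"
    proof -
      have "expectation (\<lambda>\<omega>. \<gamma>\<^sup>2 * \<mu> / (2 * L) * d k \<omega>) \<le> expectation (\<lambda>\<omega>. S (1 / real m) {1..m} (x k \<omega>))"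
        using intd intSm gain by (intro integral_mono integrable_mult_right) auto
      then have "\<gamma>\<^sup>2 * \<mu> / (2 * L) * expectation (d k) \<le> expectation (\<lambda>\<omega>. S (1 / real m) {1..m} (x k \<omega>))"
        by (simp only: integral_mult_right_zero)
      from mult_left_mono[OF this c] show ?thesis by (simp only: diff_left_mono)
    qed
    \<comment> \<open>The 4 in the rate combines two factors 2: one from minimizing the quadratic
      majorant in the step, one from strong convexity in the growth bound.\<close>
    also have "\<dots> = (1 - ?q) * expectation (d k)"
      unfolding c_def by (simp add: algebra_simps power2_eq_square)
    finally show ?thesis .
  qed
  have nonneg: "0 \<le> expectation (d k)" for k
    using bregman_dist_sq_nonneg[OF sub ne] unfolding d_def by (intro integral_nonneg_AE AE_I2) auto
  have "expectation (d 0) = expectation (\<lambda>\<omega>. bregman_dist_sq \<psi> xs0 x0 Xbar)"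
    using sb by (intro Bochner_Integration.integral_cong) (auto simp: d_def sbbp_def)
  then have "expectation (d 0) = bregman_dist_sq \<psi> xs0 x0 Xbar" by (simp add: prob_space)
  with linear_rate_iterate[of "\<lambda>k. expectation (d k)", OF nonneg step] intd show ?thesis
    unfolding d_def by simp
qed

end
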